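(* Let $\mathsf{T},\mathsf{S},\mathcal{I},\triangle$ be as in the context. Let $t$ be an object of $\mathsf{T}$ and let $R$ be a $\triangle$-congruence on $\hom_{\mathsf{T}}(t,\triangle)$ (that is, $(t,R)$ is an object of $\mathsf{Q}$). For any family $\Sigma=\{\sigma_i\}_{i\in I}$ of subobjects of $\mathcal{I}(t)$ such that for each $\sigma_i$ there exists an $\mathsf{S}$-arrow $m_i$ with $\sigma_i=\mathbb{V}(R)\circ m_i$ (i.e. $\sigma_i\leq\mathbb{V}(R)$) and such that the family of $\mathsf{S}$-arrows $\{m_i\}_{i\in I}$ is jointly epic in $\mathsf{S}$, the following are equivalent. (i) $R=\mathbb{C}(\mathbb{V}(R))$. (ii) $R=\bigcap_{i\in I}\mathbb{C}(\sigma_i)$.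
   Context: Setting: $\mathsf{T},\mathsf{S}$ are locally small categories, $\mathsf{S}$ is well-powered, $\mathcal{I}\colon\mathsf{T}\to\mathsf{S}$ is a functor and $\triangle$ is an object of $\mathsf{T}$. Standing assumptions: (1) $\mathsf{S}$ has equalisers of pairs of parallel arrows and intersections of arbitrary families of subobjects; (2) $\mathcal{I}$ preserves all powers $\triangle^J$ ($J$ a set) that exist in $\mathsf{T}$; (3) $\triangle$ is an $\mathcal{I}$-coseparator: for every object $t$ of $\mathsf{T}$ and all distinct $\mathsf{S}$-arrows $g_1\neq g_2\colon y\to\mathcal{I}(t)$ there is $f\colon t\to\triangle$ in $\mathsf{T}$ with $\mathcal{I}(f)\circ g_1\neq\mathcal{I}(f)\circ g_2$. For a subobject $s\colon\mathrm{dom}\,s\to\mathcal{I}(t)$, $\mathbb{C}(s):=\{(p,q)\in\hom_{\mathsf{T}}(t,\triangle)^2\mid\mathcal{I}(p)\circ s=\mathcal{I}(q)\circ s\}$. For a relation $R\subseteq\hom_{\mathsf{T}}(t,\triangle)^2$, $\mathbb{V}(R):=\bigwedge_{(p,q)\in R}\mathrm{Eq}(\mathcal{I}(p),\mathcal{I}(q))$, the intersection of the subobjects of $\mathcal{I}(t)$ given by equalisers of $\mathcal{I}(p),\mathcal{I}(q)\colon\mathcal{I}(t)\rightrightarrows\mathcal{I}(\triangle)$. A $\triangle$-congruence on $\hom_{\mathsf{T}}(t,\triangle)$ is an equivalence relation $R$ such that, for any set $J$ for which $\triangle^J$ exists in $\mathsf{T}$, any $g\colon\triangle^J\to\triangle$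 and any family $(p_j,q_j)_{j\in J}$ of pairs in $R$, one has $(g\circ\langle p_j\rangle_{j\in J},\,g\circ\langle q_j\rangle_{j\in J})\in R$, where $\langle p_j\rangle_{j\in J}\colon t\to\triangle^J$ is the arrow with components $p_j$. The objects of $\mathsf{Q}$ are the pairs $(t,R)$ with $R$ a $\triangle$-congruence on $\hom_{\mathsf{T}}(t,\triangle)$. A family of arrows $\{m_i\}_{i\in I}$ with common codomain $y$ is jointly epic if, for all parallel arrows $f_1,f_2\colon y\rightrightarrows z$, $f_1\circ m_i=f_2\circ m_i$ for all $i\in I$ implies $f_1=f_2$. *)

theory Defs
  imports Main
begin

section \<open>Categories and functors\<close>

record ('o, 'a) cat =
  Obj :: "'o set"
  Arr :: "'a set"
  Dom :: "'a \<Rightarrow> 'o"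
  Cod :: "'a \<Rightarrow> 'o"
  Ident :: "'o \<Rightarrow> 'a"
  Comp :: "'a \<Rightarrow> 'a \<Rightarrow> 'a"  (infixl "\<odot>\<index>" 70)

definition hom :: "('o, 'a, 'x) cat_scheme \<Rightarrow> 'o \<Rightarrow> 'o \<Rightarrow> 'a set" where
  "hom C x y = {f \<in> Arr C. Dom C f = x \<and> Cod C f = y}"

locale category =
  fixes C :: "('o, 'a) cat" (structure)
  assumes Dom_Obj: "f \<in> Arr C \<Longrightarrow> Dom C f \<in> Obj C"
    and Cod_Obj: "f \<in> Arr C \<Longrightarrow> Cod C f \<in> Obj C"
    and Ident_hom: "x \<in> Obj C \<Longrightarrow> Ident C x \<in> hom C x x"
    and Comp_hom: "\<lbrakk>g \<in> hom C y z; f \<in> hom C x y\<rbrakk> \<Longrightarrow> g \<odot> f \<in> hom C x z"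
    and Comp_Ident: "f \<in> hom C x y \<Longrightarrow> f \<odot> Ident C x = f"
    and Ident_Comp: "f \<in> hom C x y \<Longrightarrow> Ident C y \<odot> f = f"
    and Comp_assoc: "\<lbrakk>h \<in> hom C y z; g \<in> hom C x y; f \<in> hom C w x\<rbrakk>
      \<Longrightarrow> (h \<odot> g) \<odot> f = h \<odot> (g \<odot> f)"

record ('o1, 'a1, 'o2, 'a2) func =
  onObj :: "'o1 \<Rightarrow> 'o2"
  onArr :: "'a1 \<Rightarrow> 'a2"

locale cat_functor = source: category T + target: category S
  for T :: "('o1, 'a1) cat" and S :: "('o2, 'a2) cat" +
  fixes F :: "('o1, 'a1, 'o2, 'a2) func"
  assumes onObj_Obj: "x \<in> Obj T \<Longrightarrow> onObj F x \<in> Obj S"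
    and onArr_hom: "f \<in> hom T x y \<Longrightarrow> onArr F f \<in> hom S (onObj F x) (onObj F y)"
    and onArr_Ident: "x \<in> Obj T \<Longrightarrow> onArr F (Ident T x) = Ident S (onObj F x)"
    and onArr_Comp: "\<lbrakk>g \<in> hom T y z; f \<in> hom T x y\<rbrakk>
      \<Longrightarrow> onArr F (g \<odot>\<^bsub>T\<^esub> f) = onArr F g \<odot>\<^bsub>S\<^esub> onArr F f"


section \<open>Smallness\<close>

text \<open>
  The distinction between sets and proper classes is expressed by a cardinal \<open>\<kappa>\<close>: the
  collections of fewer than \<open>\<kappa>\<close> elements play the role of sets. The traditional reading takes
  for \<open>\<kappa>\<close> the inaccessible cardinal of a universe. Since \<open>\<kappa>\<close> is a cardinal on the
  type \<open>'u\<close>, every set in this sense is in bijection with some \<open>J :: 'u set\<close> with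
  \<open>small \<kappa> J\<close>, so that it suffices to let index sets range over these.
\<close>

definition small :: "'u rel \<Rightarrow> 'b set \<Rightarrow> bool" where
  "small \<kappa> A \<longleftrightarrow> (card_of A, \<kappa>) \<in> ordLess"

definition locally_small :: "'u rel \<Rightarrow> ('o, 'a) cat \<Rightarrow> bool" where
  "locally_small \<kappa> C \<longleftrightarrow> (\<forall>x\<in>Obj C. \<forall>y\<in>Obj C. small \<kappa> (hom C x y))"


section \<open>Subobjects, equalisers, intersections\<close>

definition mono_arr :: "('o, 'a) cat \<Rightarrow> 'a \<Rightarrow> bool" where
  "mono_arr C m \<longleftrightarrow> m \<in> Arr C \<and>
    (\<forall>x\<in>Obj C. \<forall>f\<in>hom C x (Dom C m). \<forall>g\<in>hom C x (Dom C m).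
      m \<odot>\<^bsub>C\<^esub> f = m \<odot>\<^bsub>C\<^esub> g \<longrightarrow> f = g)"

text \<open>Subobjects of \<open>y\<close> are handled through representatives, the monic arrows into \<open>y\<close>;
  their equivalence classes are only needed to express well-poweredness.\<close>

definition monos_into :: "('o, 'a) cat \<Rightarrow> 'o \<Rightarrow> 'a set" where
  "monos_into C y = {m. mono_arr C m \<and> Cod C m = y}"

definition sub_le :: "('o, 'a) cat \<Rightarrow> 'a \<Rightarrow> 'a \<Rightarrow> bool" where
  "sub_le C m n \<longleftrightarrow> (\<exists>k\<in>hom C (Dom C m) (Dom C n). m = n \<odot>\<^bsub>C\<^esub> k)"

definition sub_equiv :: "('o, 'a) cat \<Rightarrow> 'o \<Rightarrow> 'a rel" where
  "sub_equiv C y =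
    {(m, n). m \<in> monos_into C y \<and> n \<in> monos_into C y \<and> sub_le C m n \<and> sub_le C n m}"

definition well_powered :: "'u rel \<Rightarrow> ('o, 'a) cat \<Rightarrow> bool" where
  "well_powered \<kappa> C \<longleftrightarrow> (\<forall>y\<in>Obj C. small \<kappa> (monos_into C y // sub_equiv C y))"

definition is_equaliser :: "('o, 'a) cat \<Rightarrow> 'a \<Rightarrow> 'a \<Rightarrow> 'a \<Rightarrow> bool" where
  "is_equaliser C f g e \<longleftrightarrow>
    e \<in> Arr C \<and> Cod C e = Dom C f \<and> f \<odot>\<^bsub>C\<^esub> e = g \<odot>\<^bsub>C\<^esub> e \<and>
    (\<forall>x\<in>Obj C. \<forall>h\<in>hom C x (Dom C f). f \<odot>\<^bsub>C\<^esub> h = g \<odot>\<^bsub>C\<^esub> h \<longrightarrow>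
      (\<exists>!k. k \<in> hom C x (Dom C e) \<and> e \<odot>\<^bsub>C\<^esub> k = h))"

definition has_equalisers :: "('o, 'a) cat \<Rightarrow> bool" where
  "has_equalisers C \<longleftrightarrow> (\<forall>x\<in>Obj C. \<forall>y\<in>Obj C. \<forall>f\<in>hom C x y. \<forall>g\<in>hom C x y.
    \<exists>e. is_equaliser C f g e)"

definition Eq :: "('o, 'a) cat \<Rightarrow> 'a \<Rightarrow> 'a \<Rightarrow> 'a" where
  "Eq C f g = (SOME e. is_equaliser C f g e)"

text \<open>The intersection of a family of subobjects is its infimum in the order of subobjects. This
  includes the reading as a wide pullback: a wide pullback of monic arrows is an infimum, and
  infima are unique up to isomorphism.\<close>

definition is_intersection :: "('o, 'a) cat \<Rightarrow> 'o \<Rightarrow> 'a set \<Rightarrow> 'a \<Rightarrow> bool" where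
  "is_intersection C y \<F> m \<longleftrightarrow> m \<in> monos_into C y \<and> (\<forall>s\<in>\<F>. sub_le C m s) \<and>
    (\<forall>n\<in>monos_into C y. (\<forall>s\<in>\<F>. sub_le C n s) \<longrightarrow> sub_le C n m)"

definition has_intersections :: "('o, 'a) cat \<Rightarrow> bool" where
  "has_intersections C \<longleftrightarrow>
    (\<forall>y\<in>Obj C. \<forall>\<F>. \<F> \<subseteq> monos_into C y \<longrightarrow> (\<exists>m. is_intersection C y \<F> m))"

definition intersection :: "('o, 'a) cat \<Rightarrow> 'o \<Rightarrow> 'a set \<Rightarrow> 'a" where
  "intersection C y \<F> = (SOME m. is_intersection C y \<F> m)"

text \<open>The common codomain \<open>y\<close> is a parameter because the index set may be empty.\<close>

definition jointly_epic :: "('o, 'a) cat \<Rightarrow> 'o \<Rightarrow> 'i set \<Rightarrow> ('i \<Rightarrow> 'a) \<Rightarrow> bool" where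
  "jointly_epic C y I m \<longleftrightarrow> (\<forall>i\<in>I. m i \<in> Arr C \<and> Cod C (m i) = y) \<and>
    (\<forall>z\<in>Obj C. \<forall>f\<in>hom C y z. \<forall>g\<in>hom C y z.
      (\<forall>i\<in>I. f \<odot>\<^bsub>C\<^esub> m i = g \<odot>\<^bsub>C\<^esub> m i) \<longrightarrow> f = g)"


section \<open>Powers\<close>

definition is_power :: "('o, 'a) cat \<Rightarrow> 'o \<Rightarrow> 'j set \<Rightarrow> 'o \<Rightarrow> ('j \<Rightarrow> 'a) \<Rightarrow> bool" where
  "is_power C d J P \<pi> \<longleftrightarrow> P \<in> Obj C \<and> (\<forall>j\<in>J. \<pi> j \<in> hom C P d) \<and>
    (\<forall>x\<in>Obj C. \<forall>f. (\<forall>j\<in>J. f j \<in> hom C x d) \<longrightarrow>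
      (\<exists>!h. h \<in> hom C x P \<and> (\<forall>j\<in>J. \<pi> j \<odot>\<^bsub>C\<^esub> h = f j)))"

definition tuple :: "('o, 'a) cat \<Rightarrow> 'j set \<Rightarrow> 'o \<Rightarrow> ('j \<Rightarrow> 'a) \<Rightarrow> 'o \<Rightarrow> ('j \<Rightarrow> 'a) \<Rightarrow> 'a" where
  "tuple C J P \<pi> x f = (THE h. h \<in> hom C x P \<and> (\<forall>j\<in>J. \<pi> j \<odot>\<^bsub>C\<^esub> h = f j))"

definition preserves_powers ::
    "'u rel \<Rightarrow> ('o1, 'a1) cat \<Rightarrow> ('o2, 'a2) cat \<Rightarrow> ('o1, 'a1, 'o2, 'a2) func \<Rightarrow> 'o1 \<Rightarrow> bool" where
  "preserves_powers \<kappa> T S F d \<longleftrightarrow>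
    (\<forall>(J :: 'u set) P \<pi>. small \<kappa> J \<longrightarrow> is_power T d J P \<pi> \<longrightarrow>
      is_power S (onObj F d) J (onObj F P) (\<lambda>j. onArr F (\<pi> j)))"


section \<open>The setting\<close>

locale affine_setting = cat_functor T S F
  for \<kappa> :: "'u rel"
    and T :: "('o1, 'a1) cat"
    and S :: "('o2, 'a2) cat"
    and F :: "('o1, 'a1, 'o2, 'a2) func"
    and \<Delta> :: 'o1 +
  assumes infinite_cardinal: "Cinfinite \<kappa>"
    and locally_small_T: "locally_small \<kappa> T"
    and locally_small_S: "locally_small \<kappa> S"
    and well_powered_S: "well_powered \<kappa> S"
    and \<Delta>_Obj: "\<Delta> \<in> Obj T"
    and equalisers_S: "has_equalisers S"
    and intersections_S: "has_intersections S"
    and preserves_powers_\<Delta>: "preserves_powers \<kappa> T S F \<Delta>"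
    and coseparator_\<Delta>: "\<lbrakk>t \<in> Obj T; y \<in> Obj S; g\<^sub>1 \<in> hom S y (onObj F t); g\<^sub>2 \<in> hom S y (onObj F t);
          g\<^sub>1 \<noteq> g\<^sub>2\<rbrakk>
        \<Longrightarrow> \<exists>f\<in>hom T t \<Delta>. onArr F f \<odot>\<^bsub>S\<^esub> g\<^sub>1 \<noteq> onArr F f \<odot>\<^bsub>S\<^esub> g\<^sub>2"

definition \<C> :: "('o1, 'a1) cat \<Rightarrow> ('o2, 'a2) cat \<Rightarrow> ('o1, 'a1, 'o2, 'a2) func \<Rightarrow> 'o1 \<Rightarrow> 'o1 \<Rightarrow>
    'a2 \<Rightarrow> 'a1 rel" where
  "\<C> T S F \<Delta> t s =
    {(p, q) \<in> hom T t \<Delta> \<times> hom T t \<Delta>. onArr F p \<odot>\<^bsub>S\<^esub> s = onArr F q \<odot>\<^bsub>S\<^esub> s}"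

definition \<V> :: "('o2, 'a2) cat \<Rightarrow> ('o1, 'a1, 'o2, 'a2) func \<Rightarrow> 'o1 \<Rightarrow> 'a1 rel \<Rightarrow> 'a2" where
  "\<V> S F t R = intersection S (onObj F t) {Eq S (onArr F p) (onArr F q) | p q. (p, q) \<in> R}"

definition \<Delta>_congruence :: "'u rel \<Rightarrow> ('o1, 'a1) cat \<Rightarrow> 'o1 \<Rightarrow> 'o1 \<Rightarrow> 'a1 rel \<Rightarrow> bool" where
  "\<Delta>_congruence \<kappa> T \<Delta> t R \<longleftrightarrow> equiv (hom T t \<Delta>) R \<and>
    (\<forall>(J :: 'u set) P \<pi>. small \<kappa> J \<longrightarrow> is_power T \<Delta> J P \<pi> \<longrightarrow>
      (\<forall>g\<in>hom T P \<Delta>. \<forall>p q. (\<forall>j\<in>J. (p j, q j) \<in> R) \<longrightarrow>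
        (g \<odot>\<^bsub>T\<^esub> tuple T J P \<pi> t p, g \<odot>\<^bsub>T\<^esub> tuple T J P \<pi> t q) \<in> R))"

end

theory Submission
  imports Defs
begin

text \<open>
  Since \<open>\<sigma> i = \<V> R \<odot> m i\<close> and the \<open>m i\<close> are jointly epic, two arrows out of \<open>\<I> t\<close> agree on all
  \<open>\<sigma> i\<close> exactly when they agree on \<open>\<V> R\<close>. Hence \<open>\<C> (\<V> R) = (\<Inter>i. \<C> (\<sigma> i))\<close>, and the two
  conditions compare \<open>R\<close> with the same relation.
\<close>

lemma (in category) hom_Obj:
  assumes "f \<in> hom C x y"
  shows "x \<in> Obj C" and "y \<in> Obj C"
  using assms Dom_Obj Cod_Obj by (auto simp: hom_def)

text \<open>If \<open>e \<odot> u = e \<odot> v\<close>, then \<open>u\<close> and \<open>v\<close>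
  both mediate the same arrow through the equaliser, and mediating arrows are unique. Monicity is
  not part of \<open>is_equaliser\<close>, but intersections are formed of monic arrows.\<close>

lemma (in category) equaliser_mono:
  assumes e: "is_equaliser C f g e"
    and f: "f \<in> hom C x y" and g: "g \<in> hom C x y"
  shows "e \<in> monos_into C x"
proof -
  have dom: "Dom C f = x"
    using f by (simp add: hom_def)
  have e_hom: "e \<in> hom C (Dom C e) x" and fe: "f \<odot> e = g \<odot> e"
    using e dom by (auto simp: is_equaliser_def hom_def)
  have "u = v" if w: "w \<in> Obj C" and u: "u \<in> hom C w (Dom C e)" and v: "v \<in> hom C w (Dom C e)"
    and eq: "e \<odot> u = e \<odot> v" for w u v
  proof -
    have h: "e \<odot> u \<in> hom C w x"
      using Comp_hom[OF e_hom u] .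
    have "f \<odot> (e \<odot> u) = g \<odot> (e \<odot> u)"
      using Comp_assoc[OF f e_hom u] Comp_assoc[OF g e_hom u] fe by simp
    then have "\<exists>!k. k \<in> hom C w (Dom C e) \<and> e \<odot> k = e \<odot> u"
      using e w h dom unfolding is_equaliser_def by blast
    then show ?thesis
      using u v eq by metis
  qed
  then show ?thesis
    using e_hom by (auto simp: monos_into_def mono_arr_def hom_def)
qed

text \<open>By associativity, joint epicness is applied to the parallel pair
  \<open>f \<odot> v\<close>, \<open>g \<odot> v\<close> out of \<open>x\<close>.\<close>

lemma (in category) jointly_epic_factor_iff:
  assumes epic: "jointly_epic C x I m"
    and v: "v \<in> hom C x y"
    and f: "f \<in> hom C y z" and g: "g \<in> hom C y z"
  shows "f \<odot> v = g \<odot> v \<longleftrightarrow> (\<forall>i\<in>I. f \<odot> (v \<odot> m i) = g \<odot> (v \<odot> m i))"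
proof -
  have "f \<odot> (v \<odot> m i) = (f \<odot> v) \<odot> m i" "g \<odot> (v \<odot> m i) = (g \<odot> v) \<odot> m i" if "i \<in> I" for i
  proof -
    have "m i \<in> hom C (Dom C (m i)) x"
      using epic that by (simp add: jointly_epic_def hom_def)
    then show "f \<odot> (v \<odot> m i) = (f \<odot> v) \<odot> m i" "g \<odot> (v \<odot> m i) = (g \<odot> v) \<odot> m i"
      using Comp_assoc f g v by auto
  qed
  moreover have "f \<odot> v = g \<odot> v" if "\<forall>i\<in>I. (f \<odot> v) \<odot> m i = (g \<odot> v) \<odot> m i"
    using epic that hom_Obj(2)[OF f] Comp_hom[OF f v] Comp_hom[OF g v]
    unfolding jointly_epic_def by blast
  ultimately show ?thesis
    by auto
qed

text \<open>\<open>Eq\<close> and \<open>intersection\<close> are Hilbert choices, so they have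
  their defining properties only once witnesses exist: first an equaliser for each pair in
  \<open>R\<close>, then an intersection of the resulting family of monic arrows.\<close>

lemma (in affine_setting) \<V>_monos_into:
  assumes t: "t \<in> Obj T" and R: "R \<subseteq> hom T t \<Delta> \<times> hom T t \<Delta>"
  shows "\<V> S F t R \<in> monos_into S (onObj F t)"
proof -
  have "Eq S (onArr F p) (onArr F q) \<in> monos_into S (onObj F t)" if "(p, q) \<in> R" for p q
  proof -
    have hom: "onArr F p \<in> hom S (onObj F t) (onObj F \<Delta>)"
      "onArr F q \<in> hom S (onObj F t) (onObj F \<Delta>)"
      using that R onArr_hom by auto
    then have "\<exists>e. is_equaliser S (onArr F p) (onArr F q) e"
      using equalisers_S target.hom_Obj unfolding has_equalisers_def by blast
    then have "is_equaliser S (onArr F p) (onArr F q) (Eq S (onArr F p) (onArr F q))"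
      unfolding Eq_def by (rule someI_ex)
    then show ?thesis
      using target.equaliser_mono hom by blast
  qed
  then have "{Eq S (onArr F p) (onArr F q) | p q. (p, q) \<in> R} \<subseteq> monos_into S (onObj F t)"
    by auto
  then have "\<exists>v. is_intersection S (onObj F t) {Eq S (onArr F p) (onArr F q) | p q. (p, q) \<in> R} v"
    using intersections_S onObj_Obj[OF t] unfolding has_intersections_def by blast
  then have "is_intersection S (onObj F t) {Eq S (onArr F p) (onArr F q) | p q. (p, q) \<in> R}
      (\<V> S F t R)"
    unfolding \<V>_def intersection_def by (rule someI_ex)
  then show ?thesis
    by (simp add: is_intersection_def)
qed

text \<open>The factor \<open>hom T t \<Delta> \<times> hom T t \<Delta>\<close> matters for empty
  \<open>I\<close>: the HOL intersection is then \<open>UNIV\<close>, whereas the intended empty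
  intersection is the total relation on the hom-set. In that case all parallel arrows out of
  \<open>x\<close> coincide, so the left side is total too.\<close>

lemma (in cat_functor) \<C>_jointly_epic_factor:
  assumes "v \<in> hom S x (onObj F t)" and "jointly_epic S x I m"
  shows "\<C> T S F \<Delta> t v =
    (hom T t \<Delta> \<times> hom T t \<Delta>) \<inter> (\<Inter>i\<in>I. \<C> T S F \<Delta> t (v \<odot>\<^bsub>S\<^esub> m i))"
  using target.jointly_epic_factor_iff[OF assms(2,1) onArr_hom onArr_hom]
  by (auto simp: \<C>_def)

theorem theorem2p10:
  fixes \<kappa> :: "'u rel"
    and T :: "('o1, 'a1) cat"
    and S :: "('o2, 'a2) cat"
    and F :: "('o1, 'a1, 'o2, 'a2) func"
    and \<Delta> t :: 'o1
    and R :: "'a1 rel"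
    and I :: "'i set"
    and \<sigma> m :: "'i \<Rightarrow> 'a2"
  assumes "affine_setting \<kappa> T S F \<Delta>"
    and "t \<in> Obj T"
    and "\<Delta>_congruence \<kappa> T \<Delta> t R"
    and "\<And>i. i \<in> I \<Longrightarrow> \<sigma> i \<in> monos_into S (onObj F t)"
    and "\<And>i. i \<in> I \<Longrightarrow> m i \<in> hom S (Dom S (\<sigma> i)) (Dom S (\<V> S F t R))"
    and "\<And>i. i \<in> I \<Longrightarrow> \<sigma> i = \<V> S F t R \<odot>\<^bsub>S\<^esub> m i"
    and "jointly_epic S (Dom S (\<V> S F t R)) I m"
  shows "R = \<C> T S F \<Delta> t (\<V> S F t R) \<longleftrightarrow>
    R = (hom T t \<Delta> \<times> hom T t \<Delta>) \<inter> (\<Inter>i\<in>I. \<C> T S F \<Delta> t (\<sigma> i))"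
proof -
  interpret affine_setting \<kappa> T S F \<Delta>
    by fact
  \<comment> \<open>A congruence is an equivalence relation on the hom-set; this inclusion makes the
    images of related arrows parallel, so that their equalisers exist.\<close>
  have "R \<subseteq> hom T t \<Delta> \<times> hom T t \<Delta>"
    using assms(3) by (auto simp: \<Delta>_congruence_def dest: equiv_type)
  then have "\<V> S F t R \<in> hom S (Dom S (\<V> S F t R)) (onObj F t)"
    using \<V>_monos_into assms(2) by (auto simp: monos_into_def mono_arr_def hom_def)
  then have "\<C> T S F \<Delta> t (\<V> S F t R) =
      (hom T t \<Delta> \<times> hom T t \<Delta>) \<inter> (\<Inter>i\<in>I. \<C> T S F \<Delta> t (\<V> S F t R \<odot>\<^bsub>S\<^esub> m i))"
    using \<C>_jointly_epic_factor assms(7) by blast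
  then show ?thesis
    using assms(6) by simp
qed

end
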